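(* Let $\mathbf{F}$ be Thompson's group, let $S$ be a finite generating set of $\mathbf F$, and let $k\ge2$ be a fixed integer. Then there exists a constant $C>0$ such that $\mathcal{A}_{\mathbf{F}}^S (n) \leq C n$ for all $n\in\mathbb{N}$, where $\mathcal A_{\mathbf F}^S$ is the lawlessness growth function of $\mathbf F$ (defined using words in $F_k$; the group $\mathbf F$ is lawless).
   Context: $\mathbb{N}=\{1,2,\dots\}$. Thompson's group $\mathbf F$ is the subgroup of the homeomorphism group of $\mathbb R$ generated by $A(x)=x+1$ and $B$, where $B(x)=x$ for $x\le 0$, $B(x)=2x$ for $x\in(0,1]$ and $B(x)=x+1$ for $x>1$. For a group $\Gamma$ with finite generating set $S$, $|g|_S$ denotes the word length of $g\in\Gamma$ with respect to $S$ (letters from $S\cup S^{-1}$). $F_k$ is the free group on $x_1,\dots,x_k$ and $|w|$ is the reduced length of $w\in F_k$. For $w\in F_k$ and $\mathbf g=(g_1,\dots,g_k)\in\Gamma^k$, $w(\mathbf g)$ is the image of $w$ under the homomorphism $F_k\to\Gamma$, $x_i\mapsto g_i$. A law for $\Gamma$ is a nontrivial $w$ in some $F_k$ with $w(\mathbf g)=1$ for all $\mathbf g\in\Gamma^k$; $\Gamma$ is lawless if it has no laws. For $\Gamma$ lawless and $1\neq w\in F_k$, the complexity is $\chi_\Gamma^S(w)=\min\{\sum_{i=1}^k|g_i|_S : \mathbf g\in\Gamma^k,\ w(\mathbf g)\neq 1\}$, and the lawlessness growth function is $\mathcal A_\Gamma^S(n)=\max\{\chi_\Gamma^S(w) : 1\neq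 w\in F_k,\ |w|\le n\}$, where the rank $k\ge 2$ is fixed. *)

theory Defs
  imports "HOL-Analysis.Analysis" "HOL-Algebra.Algebra"
begin

section \<open>Thompson's group\<close>

definition homeo_group :: "(real \<Rightarrow> real) monoid" where
  "homeo_group = \<lparr>carrier = {f. \<exists>g. homeomorphism UNIV UNIV f g}, mult = (\<circ>), one = id\<rparr>"

definition thompson_A :: "real \<Rightarrow> real" where
  "thompson_A x = x + 1"

definition thompson_B :: "real \<Rightarrow> real" where
  "thompson_B x = (if x \<le> 0 then x else if x \<le> 1 then 2 * x else x + 1)"

definition thompson_F :: "(real \<Rightarrow> real) monoid" where
  "thompson_F = subgroup_generated homeo_group {thompson_A, thompson_B}"

lemma homeo_group_simps [simp]:
  "f \<in> carrier homeo_group \<longleftrightarrow> (\<exists>g. homeomorphism UNIV UNIV f g)"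
  "f \<otimes>\<^bsub>homeo_group\<^esub> g = f \<circ> g"
  "\<one>\<^bsub>homeo_group\<^esub> = id"
  by (simp_all add: homeo_group_def)

lemma group_homeo_group: "group homeo_group"
proof (rule groupI)
  fix f g assume "f \<in> carrier homeo_group" "g \<in> carrier homeo_group"
  then show "f \<otimes>\<^bsub>homeo_group\<^esub> g \<in> carrier homeo_group"
    by (auto intro: homeomorphism_compose)
next
  fix f assume "f \<in> carrier homeo_group"
  then obtain g where g: "homeomorphism UNIV UNIV f g" by auto
  then have "homeomorphism UNIV UNIV g f" by (rule homeomorphism_symD)
  moreover have "g \<circ> f = id" using g by (auto simp: homeomorphism_def)
  ultimately show "\<exists>g\<in>carrier homeo_group. g \<otimes>\<^bsub>homeo_group\<^esub> f = \<one>\<^bsub>homeo_group\<^esub>"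
    by (metis homeo_group_simps)
qed (auto simp: homeomorphism_def intro!: exI[of _ id])

lemma thompson_A_homeo: "thompson_A \<in> carrier homeo_group"
proof -
  have "homeomorphism UNIV UNIV thompson_A (\<lambda>x. x - 1)"
    by (rule homeomorphismI) (auto simp: thompson_A_def [abs_def] intro!: continuous_intros)
  then show ?thesis by auto
qed

lemma thompson_B_homeo: "thompson_B \<in> carrier homeo_group"
proof -
  define C :: "real \<Rightarrow> real"
    where "C = (\<lambda>x. if x \<le> 0 then x else if x \<le> 2 then x / 2 else x - 1)"
  have B: "thompson_B = (\<lambda>x. min x 0 + min (max (2 * x) 0) 2 + max (x - 1) 0)"
    by (auto simp: thompson_B_def fun_eq_iff min_def max_def)
  have C: "C = (\<lambda>x. min x 0 + min (max (x / 2) 0) 1 + max (x - 2) 0)"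
    by (auto simp: C_def fun_eq_iff min_def max_def)
  have "homeomorphism UNIV UNIV thompson_B C"
  proof (rule homeomorphismI)
    show "continuous_on UNIV thompson_B" unfolding B by (intro continuous_intros)
    show "continuous_on UNIV C" unfolding C by (intro continuous_intros) auto
  qed (auto simp: thompson_B_def C_def)
  then show ?thesis by auto
qed

lemma group_thompson_F: "group thompson_F"
  unfolding thompson_F_def using group_homeo_group by (rule group.group_subgroup_generated)

lemma carrier_thompson_F:
  "carrier thompson_F = generate homeo_group {thompson_A, thompson_B}"
proof -
  have "carrier homeo_group \<inter> {thompson_A, thompson_B} = {thompson_A, thompson_B}"
    using thompson_A_homeo thompson_B_homeo by blast
  then show ?thesis by (simp add: thompson_F_def carrier_subgroup_generated)
qed


section \<open>Free groups\<close>

text \<open>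
  The letter \<open>(i, True)\<close> stands for \<open>x\<^sub>i\<close> and \<open>(i, False)\<close> for its inverse. The free group of
  rank \<open>k\<close> is realised on the reduced words in \<open>x\<^sub>1, \<dots>, x\<^sub>k\<close>, so the reduced length of an
  element is the length of the list.
\<close>

type_synonym letter = "nat \<times> bool"

definition inv_letter :: "letter \<Rightarrow> letter" where
  "inv_letter a = (fst a, \<not> snd a)"

definition reduced_word :: "letter list \<Rightarrow> bool" where
  "reduced_word = successively (\<lambda>a b. b \<noteq> inv_letter a)"

fun push :: "letter \<Rightarrow> letter list \<Rightarrow> letter list" where
  "push a [] = [a]"
| "push a (b # w) = (if b = inv_letter a then w else a # b # w)"

definition free_group :: "nat \<Rightarrow> letter list monoid" where
  "free_group k =
    \<lparr>carrier = {w. fst ` set w \<subseteq> {1..k} \<and> reduced_word w}, mult = foldr push, one = []\<rparr>"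

definition list_mult :: "('a, 'b) monoid_scheme \<Rightarrow> 'a list \<Rightarrow> 'a" where
  "list_mult G xs = foldr (\<otimes>\<^bsub>G\<^esub>) xs \<one>\<^bsub>G\<^esub>"

text \<open>
  \<open>word_eval G g\<close> is the homomorphism from the free group to \<open>G\<close> sending \<open>x\<^sub>i\<close> to \<open>g i\<close>; only
  the values of \<open>g\<close> on \<open>{1..k}\<close> matter.
\<close>

definition word_eval :: "('a, 'b) monoid_scheme \<Rightarrow> (nat \<Rightarrow> 'a) \<Rightarrow> letter list \<Rightarrow> 'a" where
  "word_eval G g w = list_mult G (map (\<lambda>(i, b). if b then g i else inv\<^bsub>G\<^esub> (g i)) w)"

lemma free_group_simps [simp]:
  "w \<in> carrier (free_group k) \<longleftrightarrow> fst ` set w \<subseteq> {1..k} \<and> reduced_word w"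
  "u \<otimes>\<^bsub>free_group k\<^esub> v = foldr push u v"
  "\<one>\<^bsub>free_group k\<^esub> = []"
  by (simp_all add: free_group_def)

lemma inv_letter_simps [simp]:
  "inv_letter (inv_letter a) = a" "fst (inv_letter a) = fst a" "inv_letter a \<noteq> a"
  by (auto simp: inv_letter_def prod_eq_iff)

lemma reduced_simps [simp]:
  "reduced_word []" "reduced_word [a]"
  "reduced_word (a # b # w) \<longleftrightarrow> b \<noteq> inv_letter a \<and> reduced_word (b # w)"
  by (simp_all add: reduced_word_def)

lemma reduced_tl: "reduced_word (a # w) \<Longrightarrow> reduced_word w"
  by (cases w) auto

lemma reduced_push: "reduced_word w \<Longrightarrow> reduced_word (push a w)"
  by (cases w) (auto dest: reduced_tl)

lemma push_push_inv: "reduced_word w \<Longrightarrow> push a (push (inv_letter a) w) = w"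
  by (cases w rule: remdups_adj.cases) auto

lemma push_reduced: "reduced_word (a # w) \<Longrightarrow> push a w = a # w"
  by (cases w) auto

lemma reduced_foldr_push: "reduced_word v \<Longrightarrow> reduced_word (foldr push u v)"
  by (induction u) (auto intro: reduced_push)

lemma set_push: "set (push a w) \<subseteq> insert a (set w)"
  by (cases w) auto

lemma set_foldr_push: "set (foldr push u v) \<subseteq> set u \<union> set v"
  by (induction u) (use set_push in fastforce)+

lemma letters_foldr_push:
  assumes "fst ` set u \<subseteq> K" "fst ` set v \<subseteq> K"
  shows "fst ` set (foldr push u v) \<subseteq> K"
proof -
  have "fst ` set (foldr push u v) \<subseteq> fst ` (set u \<union> set v)"
    by (intro image_mono set_foldr_push)
  also have "\<dots> \<subseteq> K" using assms by (simp add: image_Un)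
  finally show ?thesis .
qed

lemma foldr_push_push:
  assumes "reduced_word v" "reduced_word w"
  shows "foldr push (push a v) w = push a (foldr push v w)"
proof (cases v)
  case (Cons b x)
  then show ?thesis
    using push_push_inv[OF reduced_foldr_push[OF assms(2)], of a x] by auto
qed auto

lemma foldr_push_assoc:
  assumes "reduced_word v" "reduced_word w"
  shows "foldr push (foldr push u v) w = foldr push u (foldr push v w)"
  by (induction u) (auto simp: foldr_push_push reduced_foldr_push assms)

lemma reduced_inverse:
  assumes "reduced_word w"
  shows "reduced_word (rev (map inv_letter w))"
proof -
  have "(inv_letter x = inv_letter (inv_letter y)) = (y = inv_letter x)" for x y
    by auto
  then show ?thesis
    using assms unfolding reduced_word_def successively_rev successively_map
    by (auto elim!: successively_mono)
qed

lemma foldr_push_inverse: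
  "reduced_word w \<Longrightarrow> foldr push (rev (map inv_letter w)) w = []"
proof (induction w)
  case (Cons a w)
  then show ?case by (auto dest: reduced_tl)
qed simp

lemma group_free_group: "group (free_group k)"
proof (rule groupI)
  fix u v assume "u \<in> carrier (free_group k)" "v \<in> carrier (free_group k)"
  then show "u \<otimes>\<^bsub>free_group k\<^esub> v \<in> carrier (free_group k)"
    by (simp add: reduced_foldr_push letters_foldr_push)
next
  fix w assume w: "w \<in> carrier (free_group k)"
  show "\<exists>v\<in>carrier (free_group k). v \<otimes>\<^bsub>free_group k\<^esub> w = \<one>\<^bsub>free_group k\<^esub>"
  proof (rule bexI)
    show "rev (map inv_letter w) \<otimes>\<^bsub>free_group k\<^esub> w = \<one>\<^bsub>free_group k\<^esub>"
      using w by (simp add: foldr_push_inverse)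
    show "rev (map inv_letter w) \<in> carrier (free_group k)"
      using w by (auto simp: reduced_inverse)
  qed
qed (auto simp: foldr_push_assoc)

context group
begin

lemma word_eval_Nil [simp]: "word_eval G g [] = \<one>"
  by (simp add: word_eval_def list_mult_def)

lemma word_eval_Cons:
  "word_eval G g (a # w) = (if snd a then g (fst a) else inv (g (fst a))) \<otimes> word_eval G g w"
  by (cases a) (simp add: word_eval_def list_mult_def)

lemma word_eval_closed:
  assumes "g \<in> {1..k} \<rightarrow> carrier G" "fst ` set w \<subseteq> {1..k}"
  shows "word_eval G g w \<in> carrier G"
  using assms(2)
proof (induction w)
  case (Cons a w)
  with assms(1) have "g (fst a) \<in> carrier G" by auto
  with Cons show ?case by (auto simp: word_eval_Cons)
qed auto

lemma word_eval_push:
  assumes g: "g \<in> {1..k} \<rightarrow> carrier G" and "fst ` set (a # w) \<subseteq> {1..k}"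
  shows "word_eval G g (push a w) = word_eval G g (a # w)"
proof (cases w)
  case (Cons b v)
  then have "g (fst a) \<in> carrier G" "word_eval G g v \<in> carrier G"
    using assms word_eval_closed[OF g, of v] by auto
  then show ?thesis
    using Cons by (auto simp: word_eval_Cons inv_letter_def simp flip: m_assoc)
qed auto

lemma word_eval_mult:
  assumes g: "g \<in> {1..k} \<rightarrow> carrier G"
    and "fst ` set u \<subseteq> {1..k}" and v: "fst ` set v \<subseteq> {1..k}"
  shows "word_eval G g (foldr push u v) = word_eval G g u \<otimes> word_eval G g v"
  using assms(2)
proof (induction u)
  case Nil
  then show ?case using word_eval_closed[OF g v] by simp
next
  case (Cons a u)
  have "fst ` set (a # foldr push u v) \<subseteq> {1..k}"
    using Cons.prems letters_foldr_push[of u "{1..k}" v] v by simp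
  moreover have "g (fst a) \<in> carrier G" using Cons.prems g by auto
  ultimately show ?case
    using Cons word_eval_closed[OF g v] word_eval_closed[OF g, of u]
    by (simp add: word_eval_push[OF g] word_eval_Cons m_assoc)
qed

lemma word_eval_hom:
  assumes "g \<in> {1..k} \<rightarrow> carrier G"
  shows "word_eval G g \<in> hom (free_group k) G"
  by (rule homI) (use assms in \<open>auto simp: word_eval_mult word_eval_closed\<close>)

lemma word_eval_generator:
  assumes "g i \<in> carrier G"
  shows "word_eval G g [(i, True)] = g i"
  using assms by (simp add: word_eval_Cons)

end


section \<open>Laws and lawlessness growth\<close>

definition word_length :: "('a, 'b) monoid_scheme \<Rightarrow> 'a set \<Rightarrow> 'a \<Rightarrow> nat" where
  "word_length G S g =
    (LEAST n. \<exists>xs. set xs \<subseteq> S \<union> (\<lambda>s. inv\<^bsub>G\<^esub> s) ` S \<and> length xs = n \<and> list_mult G xs = g)"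

definition is_law :: "('a, 'b) monoid_scheme \<Rightarrow> nat \<Rightarrow> letter list \<Rightarrow> bool" where
  "is_law G k w \<longleftrightarrow> w \<in> carrier (free_group k) \<and> w \<noteq> \<one>\<^bsub>free_group k\<^esub> \<and>
    (\<forall>g \<in> {1..k} \<rightarrow>\<^sub>E carrier G. word_eval G g w = \<one>\<^bsub>G\<^esub>)"

definition lawless :: "('a, 'b) monoid_scheme \<Rightarrow> bool" where
  "lawless G \<longleftrightarrow> (\<nexists>k w. is_law G k w)"

text \<open>
  Meaningful only if \<open>w\<close> is not a law for \<open>G\<close>; otherwise the minimum is over the empty set.
\<close>

definition complexity ::
    "('a, 'b) monoid_scheme \<Rightarrow> 'a set \<Rightarrow> nat \<Rightarrow> letter list \<Rightarrow> nat" where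
  "complexity G S k w =
    (LEAST m. \<exists>g \<in> {1..k} \<rightarrow>\<^sub>E carrier G.
      word_eval G g w \<noteq> \<one>\<^bsub>G\<^esub> \<and> m = (\<Sum>i = 1..k. word_length G S (g i)))"

definition lawlessness_growth ::
    "('a, 'b) monoid_scheme \<Rightarrow> 'a set \<Rightarrow> nat \<Rightarrow> nat \<Rightarrow> nat" where
  "lawlessness_growth G S k n =
    Max (complexity G S k `
      {w \<in> carrier (free_group k). w \<noteq> \<one>\<^bsub>free_group k\<^esub> \<and> length w \<le> n})"

lemma finite_words:
  "finite {w \<in> carrier (free_group k). w \<noteq> \<one>\<^bsub>free_group k\<^esub> \<and> length w \<le> n}"
proof (rule finite_subset)
  show "finite {w. set w \<subseteq> {1..k} \<times> (UNIV :: bool set) \<and> length w \<le> n}"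
    by (rule finite_lists_length_le) auto
qed (fastforce simp: image_subset_iff)

lemma words_nonempty:
  assumes "1 \<le> k" "1 \<le> n"
  shows "{w \<in> carrier (free_group k). w \<noteq> \<one>\<^bsub>free_group k\<^esub> \<and> length w \<le> n} \<noteq> {}"
  using assms by (auto intro!: exI[of _ "[(1, True)]"])

end

theory Submission
  imports Defs
begin

text \<open>
  Let \<open>w\<close> be a reduced word, read from right to left as a sequence of steps \<open>t = 0, \<dots>, |w| - 1\<close>.
  Elements \<open>g\<^sub>j\<close> of \<open>F\<close> are built such that step \<open>t\<close> moves the point \<open>t\<close> to \<open>t + 1\<close>, whence
  \<open>w(g)\<close> moves \<open>0\<close> to \<open>|w|\<close>. Let \<open>f\<^sub>t\<close> be the conjugate by \<open>A\<^sup>t\<close> of an element that is supported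
  on \<open>[-1, 2]\<close> and maps \<open>0\<close> to \<open>1\<close>. A step \<open>x\<^sub>j\<close> multiplies \<open>g\<^sub>j\<close> by \<open>f\<^sub>t\<close> on the right and a step
  \<open>x\<^sub>j\<inverse>\<close> multiplies it by \<open>f\<^sub>t\<inverse>\<close> on the left; as \<open>w\<close> is reduced, this does not disturb the earlier
  steps. So \<open>g\<^sub>j\<close> is \<open>v\<inverse> u\<close> for two products \<open>u\<close>, \<open>v\<close> of conjugates \<open>f\<^sub>t\<close> with increasing \<open>t\<close>, in
  which the powers of \<open>A\<close> telescope, so that its length is linear in \<open>|w|\<close>.
\<close>

section \<open>Word length\<close>

context group
begin

lemma list_mult_Nil [simp]: "list_mult G [] = \<one>"
  by (simp add: list_mult_def)

lemma list_mult_Cons [simp]: "list_mult G (x # xs) = x \<otimes> list_mult G xs"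
  by (simp add: list_mult_def)

lemma list_mult_closed: "set xs \<subseteq> carrier G \<Longrightarrow> list_mult G xs \<in> carrier G"
  by (induction xs) auto

lemma list_mult_append:
  assumes "set xs \<subseteq> carrier G" "set ys \<subseteq> carrier G"
  shows "list_mult G (xs @ ys) = list_mult G xs \<otimes> list_mult G ys"
  using assms by (induction xs) (auto simp: list_mult_closed m_assoc)

lemma list_mult_rev_inv:
  assumes "set xs \<subseteq> carrier G"
  shows "list_mult G (rev (map (m_inv G) xs)) = inv (list_mult G xs)"
  using assms
proof (induction xs)
  case (Cons x xs)
  have "set (rev (map (m_inv G) xs)) \<subseteq> carrier G"
    using Cons.prems by auto
  then show ?case
    using Cons by (simp add: list_mult_append list_mult_closed inv_mult_group)
qed simp

context
  fixes S
  assumes gen: "S \<subseteq> carrier G" "generate G S = carrier G"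
begin

lemma letters_subset_carrier: "S \<union> m_inv G ` S \<subseteq> carrier G"
  using gen by auto

lemma word_length_le:
  assumes "set xs \<subseteq> S \<union> m_inv G ` S"
  shows "word_length G S (list_mult G xs) \<le> length xs"
  unfolding word_length_def using assms by (intro Least_le) auto

lemma inv_letters:
  assumes "set xs \<subseteq> S \<union> m_inv G ` S"
  shows "set (rev (map (m_inv G) xs)) \<subseteq> S \<union> m_inv G ` S"
  using assms gen(1) by (force simp: subset_iff)

lemma generators_spell:
  assumes "g \<in> carrier G"
  shows "\<exists>xs. set xs \<subseteq> S \<union> m_inv G ` S \<and> list_mult G xs = g"
proof -
  have "g \<in> generate G S" using assms gen by simp
  then show ?thesis
  proof induction
    case one
    show ?case by (intro exI[of _ "[]"]) simp
  next
    case (incl h)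
    then show ?case using gen(1) by (intro exI[of _ "[h]"]) auto
  next
    case (inv h)
    then show ?case using gen(1) by (intro exI[of _ "[m_inv G h]"]) auto
  next
    case (eng h1 h2)
    then obtain xs ys where "set xs \<subseteq> S \<union> m_inv G ` S" "list_mult G xs = h1"
      "set ys \<subseteq> S \<union> m_inv G ` S" "list_mult G ys = h2" by blast
    then show ?case
      using letters_subset_carrier by (intro exI[of _ "xs @ ys"]) (auto intro!: list_mult_append)
  qed
qed

text \<open>Since \<open>S\<close> generates, the set under the \<open>LEAST\<close> in
  \<open>word_length\<close> is nonempty and the minimum is attained. The bounds below concatenate
  or invert such spellings.\<close>

lemma shortest_spelling:
  assumes "g \<in> carrier G"
  obtains xs where "set xs \<subseteq> S \<union> m_inv G ` S" "list_mult G xs = g"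
    "length xs = word_length G S g"
proof -
  have "\<exists>n xs. set xs \<subseteq> S \<union> m_inv G ` S \<and> length xs = n \<and> list_mult G xs = g"
    using generators_spell[OF assms] by blast
  from LeastI_ex[OF this] show ?thesis
    using that unfolding word_length_def by blast
qed

lemma word_length_one [simp]: "word_length G S \<one> = 0"
  using word_length_le[of "[]"] by simp

lemma word_length_mult:
  assumes "g \<in> carrier G" "h \<in> carrier G"
  shows "word_length G S (g \<otimes> h) \<le> word_length G S g + word_length G S h"
proof -
  obtain xs where xs: "set xs \<subseteq> S \<union> m_inv G ` S" "list_mult G xs = g"
      "length xs = word_length G S g"
    using shortest_spelling[OF assms(1)] .
  obtain ys where ys: "set ys \<subseteq> S \<union> m_inv G ` S" "list_mult G ys = h"
      "length ys = word_length G S h"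
    using shortest_spelling[OF assms(2)] .
  have "set xs \<subseteq> carrier G" "set ys \<subseteq> carrier G"
    using xs(1) ys(1) letters_subset_carrier by blast+
  then have "list_mult G (xs @ ys) = g \<otimes> h"
    using xs(2) ys(2) by (simp add: list_mult_append)
  then show ?thesis
    using word_length_le[of "xs @ ys"] xs ys by auto
qed

lemma word_length_inv:
  assumes "g \<in> carrier G"
  shows "word_length G S (inv g) \<le> word_length G S g"
proof -
  obtain xs where xs: "set xs \<subseteq> S \<union> m_inv G ` S" "list_mult G xs = g"
      "length xs = word_length G S g"
    using shortest_spelling[OF assms] .
  have "set xs \<subseteq> carrier G"
    using xs(1) letters_subset_carrier by blast
  then have "list_mult G (rev (map (m_inv G) xs)) = inv g"
    using xs(2) by (simp add: list_mult_rev_inv)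
  then show ?thesis
    using word_length_le[OF inv_letters[OF xs(1)]] xs(3) by simp
qed

lemma word_length_pow:
  assumes "g \<in> carrier G"
  shows "word_length G S (g [^] (n::nat)) \<le> word_length G S g * n"
proof (induction n)
  case (Suc n)
  then show ?case using word_length_mult[of "g [^] n" g] assms by simp
qed simp

end

end

lemma (in monoid) word_eval_cong:
  assumes "\<And>i. i \<in> fst ` set w \<Longrightarrow> g i = h i"
  shows "word_eval G g w = word_eval G h w"
proof -
  have "map (\<lambda>(i, b). if b then g i else inv (g i)) w = map (\<lambda>(i, b). if b then h i else inv (h i)) w"
    using assms by (intro map_cong) force+
  then show ?thesis by (simp only: word_eval_def)
qed

lemma (in group) complexity_le:
  assumes "g \<in> {1..k} \<rightarrow> carrier G" "fst ` set w \<subseteq> {1..k}" "word_eval G g w \<noteq> \<one>"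
  shows "complexity G S k w \<le> (\<Sum>i = 1..k. word_length G S (g i))"
  unfolding complexity_def
proof (rule Least_le, rule bexI, intro conjI)
  \<comment> \<open>\<open>complexity\<close> ranges over extensional tuples, so \<open>g\<close> is
    cut down to \<open>{1..k}\<close>, where all letters of \<open>w\<close> lie.\<close>
  have "word_eval G g w = word_eval G (restrict g {1..k}) w"
    by (rule word_eval_cong) (use assms(2) in auto)
  then show "word_eval G (restrict g {1..k}) w \<noteq> \<one>"
    using assms(3) by simp
qed (use assms(1) in auto)


section \<open>Bumps in Thompson's group\<close>

lemma thompson_F_simps [simp]:
  "f \<otimes>\<^bsub>thompson_F\<^esub> g = f \<circ> g" "\<one>\<^bsub>thompson_F\<^esub> = id"
  by (simp_all add: thompson_F_def subgroup_generated_def)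

interpretation F: group thompson_F
  by (rule group_thompson_F)

lemma F_comp_closed [intro, simp]:
  "f \<in> carrier thompson_F \<Longrightarrow> g \<in> carrier thompson_F \<Longrightarrow> f \<circ> g \<in> carrier thompson_F"
  using F.m_closed by simp

lemma thompson_A_in_F [simp]: "thompson_A \<in> carrier thompson_F"
  and thompson_B_in_F [simp]: "thompson_B \<in> carrier thompson_F"
  by (auto simp: carrier_thompson_F intro: generate.incl)

lemma F_inv_apply:
  assumes "g \<in> carrier thompson_F" "g x = y"
  shows "(inv\<^bsub>thompson_F\<^esub> g) y = x"
  using F.l_inv[OF assms(1)] assms(2) by (auto simp: fun_eq_iff)

lemma thompson_A_pow: "(thompson_A [^]\<^bsub>thompson_F\<^esub> (n::nat)) x = x + real n"
  by (induction n arbitrary: x) (simp_all add: thompson_A_def)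

text \<open>The product of \<open>A B\<inverse> A\<inverse>\<close> and
  \<open>A\<inverse> B A\<close>. The right factor is the identity up to -1 and the shift by 1 from
  0 on; the left one is the identity up to 1 and shifts back by 1 from 3 on.\<close>

definition bump :: "real \<Rightarrow> real" where
  "bump = thompson_A \<circ> inv\<^bsub>thompson_F\<^esub> thompson_B \<circ> inv\<^bsub>thompson_F\<^esub> thompson_A
    \<circ> inv\<^bsub>thompson_F\<^esub> thompson_A \<circ> thompson_B \<circ> thompson_A"

definition bump_at :: "nat \<Rightarrow> real \<Rightarrow> real" where
  "bump_at n = thompson_A [^]\<^bsub>thompson_F\<^esub> n \<circ> bump \<circ> inv\<^bsub>thompson_F\<^esub> (thompson_A [^]\<^bsub>thompson_F\<^esub> n)"

lemma bump_in_F [simp]: "bump \<in> carrier thompson_F"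
  unfolding bump_def by (intro F_comp_closed F.inv_closed) simp_all

lemma bump_at_in_F [simp]: "bump_at n \<in> carrier thompson_F"
  unfolding bump_at_def by (intro F_comp_closed F.inv_closed F.nat_pow_closed) simp_all

lemma bump_apply:
  "x \<le> -1 \<Longrightarrow> bump x = x" "2 \<le> x \<Longrightarrow> bump x = x" "bump 0 = 1"
proof -
  have A: "(inv\<^bsub>thompson_F\<^esub> thompson_A) y = y - 1" for y
    by (rule F_inv_apply) (auto simp: thompson_A_def)
  have B: "(inv\<^bsub>thompson_F\<^esub> thompson_B) y = y" if "y \<le> 0" for y
    by (rule F_inv_apply) (use that in \<open>auto simp: thompson_B_def\<close>)
  have B': "(inv\<^bsub>thompson_F\<^esub> thompson_B) y = y - 1" if "y \<ge> 2" for y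
    by (rule F_inv_apply) (use that in \<open>auto simp: thompson_B_def\<close>)
  show "x \<le> -1 \<Longrightarrow> bump x = x" "2 \<le> x \<Longrightarrow> bump x = x" "bump 0 = 1"
    by (simp_all add: bump_def A B B' thompson_A_def thompson_B_def)
qed

lemma bump_at_apply:
  shows bump_at_below: "x \<le> real n - 1 \<Longrightarrow> bump_at n x = x"
    and bump_at_above: "x \<ge> real n + 2 \<Longrightarrow> bump_at n x = x"
    and bump_at_self: "bump_at n (real n) = real n + 1"
proof -
  have "bump_at n x = bump (x - real n) + real n" for x
    unfolding bump_at_def using F_inv_apply[of "thompson_A [^]\<^bsub>thompson_F\<^esub> n" "x - real n" x]
    by (simp add: thompson_A_pow)
  then show "x \<le> real n - 1 \<Longrightarrow> bump_at n x = x" "x \<ge> real n + 2 \<Longrightarrow> bump_at n x = x"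
    "bump_at n (real n) = real n + 1"
    by (simp_all add: bump_apply)
qed


section \<open>Witnesses against a word\<close>

text \<open>The step number of a letter counts the letters to its right. Larger step numbers stand
  further right in the product and act first.\<close>

fun bump_product :: "letter \<Rightarrow> letter list \<Rightarrow> real \<Rightarrow> real" where
  "bump_product c [] = id"
| "bump_product c (a # w) =
    (if a = c then bump_product c w \<circ> bump_at (length w) else bump_product c w)"

definition witness :: "letter list \<Rightarrow> nat \<Rightarrow> real \<Rightarrow> real" where
  "witness w j = inv\<^bsub>thompson_F\<^esub> (bump_product (j, False) w) \<circ> bump_product (j, True) w"

lemma bump_product_in_F [simp]: "bump_product c w \<in> carrier thompson_F"
proof (induction w)
  case Nil
  then show ?case using F.one_closed by (simp only: bump_product.simps thompson_F_simps)
qed simp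

lemma witness_in_F [simp]: "witness w j \<in> carrier thompson_F"
  by (simp add: witness_def)

lemma witness_Nil: "witness [] j = id"
  using F.inv_one by (simp add: witness_def)

text \<open>Inverting the product for \<open>(j, False)\<close> reverses it, so its newest factor
  comes out leftmost.\<close>

lemma witness_Cons:
  "witness (a # w) j =
    (if a = (j, True) then witness w j \<circ> bump_at (length w)
     else if a = (j, False) then inv\<^bsub>thompson_F\<^esub> (bump_at (length w)) \<circ> witness w j
     else witness w j)"
  using F.inv_mult_group[of "bump_product (j, False) w" "bump_at (length w)"]
  by (auto simp: witness_def comp_assoc)

text \<open>All bumps involved have index below \<open>length w\<close>, so their supports end by
  \<open>length w + 1\<close>. Hence they do not move the endpoint of the next step.\<close>

lemma witness_above:
  "x \<ge> real (length w) + 1 \<Longrightarrow> witness w j x = x"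
proof (induction w)
  case (Cons a w)
  then show ?case
    using F_inv_apply[OF bump_at_in_F bump_at_above, of "length w" x]
    by (simp add: witness_Cons bump_at_above)
qed (simp add: witness_Nil)

text \<open>Induction over the later letters: a factor of index \<open>n\<close> fixes everything up
  to \<open>n - 1\<close>, and which point of the step it meets depends on the sign of its
  letter.\<close>

lemma witness_step:
  assumes "reduced_word w" "w = v @ a # u"
  shows "if snd a then witness w (fst a) (length u) = length u + 1
         else witness w (fst a) (length u + 1) = length u"
  using assms
proof (induction w arbitrary: v)
  case (Cons b w)
  let ?n = "length w"
  have inv_below: "(inv\<^bsub>thompson_F\<^esub> (bump_at ?n)) x = x" if "x \<le> real ?n - 1" for x
    using F_inv_apply[OF bump_at_in_F bump_at_below[OF that]] .
  show ?case
  proof (cases v)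
    case Nil
    then have "b = a" "w = u" using Cons.prems by auto
    moreover have "(inv\<^bsub>thompson_F\<^esub> (bump_at ?n)) (real ?n + 1) = real ?n"
      by (rule F_inv_apply) (simp_all add: bump_at_self)
    ultimately show ?thesis
      by (cases a) (auto simp: witness_Cons bump_at_self witness_above add.commute)
  next
    case (Cons c v')
    then have w: "w = v' @ a # u" using Cons.prems by auto
    have IH: "if snd a then witness w (fst a) (length u) = length u + 1
              else witness w (fst a) (length u + 1) = length u"
      using Cons.IH[OF reduced_tl[OF Cons.prems(1)] w] .
    have le: "real (length u) \<le> real ?n - 1" using w by simp
    show ?thesis
    proof (cases "b = inv_letter a")
      case True
      \<comment> \<open>The opposite letter acts on \<open>length u + 1\<close>. Reducedness puts
        another letter in between, which keeps this point at or below \<open>?n - 1\<close>.\<close>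
      then have "v' \<noteq> []" using Cons.prems(1) w by auto
      then have "real (length u) + 1 \<le> real ?n - 1" using w by (cases v') auto
      then show ?thesis using IH le True
        by (cases a) (auto simp: witness_Cons inv_letter_def bump_at_below inv_below add.commute)
    next
      case False
      \<comment> \<open>A letter equal to \<open>a\<close> acts only on \<open>length u\<close>,
        which is at most \<open>?n - 1\<close>; letters of other generators leave this witness
        unchanged.\<close>
      then show ?thesis using IH le
        by (cases a; cases b) (auto simp: witness_Cons inv_letter_def bump_at_below inv_below)
    qed
  qed
qed simp

lemma word_eval_witness:
  assumes "reduced_word w"
  shows "word_eval thompson_F (witness w) w 0 = real (length w)"
proof -
  \<comment> \<open>The induction runs over suffixes \<open>u\<close>, while the witness stays that
    of the whole word.\<close>
  have "word_eval thompson_F (witness w) u 0 = real (length u)" if "w = v @ u" for u v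
    using that
  proof (induction u arbitrary: v)
    case (Cons a u)
    have "word_eval thompson_F (witness w) u 0 = real (length u)"
      using Cons.IH[of "v @ [a]"] Cons.prems by simp
    then show ?case
      using witness_step[OF assms Cons.prems]
      by (auto simp: F.word_eval_Cons add.commute intro!: F_inv_apply split: if_splits)
  qed simp
  from this[of "[]"] show ?thesis by simp
qed

lemma word_eval_witness_nontrivial:
  assumes "reduced_word w" "w \<noteq> []"
  shows "word_eval thompson_F (witness w) w \<noteq> \<one>\<^bsub>thompson_F\<^esub>"
  using word_eval_witness[OF assms(1)] assms(2) by (metis F.one_closed id_apply
      length_0_conv of_nat_eq_0_iff thompson_F_simps(2))

lemma lawless_thompson_F: "lawless thompson_F"
proof -
  have False if "is_law thompson_F k w" for k w
  proof -
    have w: "fst ` set w \<subseteq> {1..k}" "reduced_word w" "w \<noteq> []"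
      and law: "\<And>g. g \<in> {1..k} \<rightarrow>\<^sub>E carrier thompson_F \<Longrightarrow> word_eval thompson_F g w = \<one>\<^bsub>thompson_F\<^esub>"
      using that by (auto simp: is_law_def)
    have "word_eval thompson_F (witness w) w = word_eval thompson_F (restrict (witness w) {1..k}) w"
      using w(1) by (intro F.word_eval_cong) auto
    also have "\<dots> = \<one>\<^bsub>thompson_F\<^esub>"
      by (rule law) auto
    finally show False using word_eval_witness_nontrivial w by blast
  qed
  then show ?thesis by (auto simp: lawless_def)
qed

section \<open>Linear length bounds for the witnesses\<close>

context
  fixes S
  assumes gen: "S \<subseteq> carrier thompson_F" "generate thompson_F S = carrier thompson_F"
begin

abbreviation "len \<equiv> word_length thompson_F S"

lemma len_comp:
  "f \<in> carrier thompson_F \<Longrightarrow> g \<in> carrier thompson_F \<Longrightarrow> len (f \<circ> g) \<le> len f + len g"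
  using F.word_length_mult[OF gen] by simp

text \<open>Appending \<open>A\<^sup>n\<close> cancels the last power of \<open>A\<close> in the product, so each step costs only \<open>O(1)\<close>.\<close>

lemma len_bump_product_pow:
  "len (bump_product c w \<circ> thompson_A [^]\<^bsub>thompson_F\<^esub> length w)
    \<le> (len bump + len thompson_A) * length w"
proof (induction w)
  case Nil
  then show ?case using F.word_length_one[OF gen] by (simp del: id_apply comp_apply)
next
  case (Cons a w)
  let ?A = "thompson_A [^]\<^bsub>thompson_F\<^esub> length w"
  let ?P = "bump_product c w \<circ> ?A"
  have P: "?P \<in> carrier thompson_F"
    by (intro F_comp_closed bump_product_in_F F.nat_pow_closed thompson_A_in_F)
  have "inv\<^bsub>thompson_F\<^esub> ?A \<circ> ?A = id"
    using F.l_inv[OF F.nat_pow_closed[OF thompson_A_in_F]] by simp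
  \<comment> \<open>Moved past the power of \<open>thompson_A\<close>, the conjugate becomes
    \<open>bump\<close> itself, whose length does not depend on the step.\<close>
  then have "bump_at (length w) \<circ> ?A = ?A \<circ> bump"
    by (simp add: bump_at_def comp_assoc)
  then have "bump_product c (a # w) \<circ> thompson_A [^]\<^bsub>thompson_F\<^esub> length (a # w) =
      (if a = c then ?P \<circ> bump \<circ> thompson_A else ?P \<circ> thompson_A)"
    by (simp add: fun_eq_iff)
  moreover have "len (?P \<circ> bump \<circ> thompson_A) \<le> len ?P + len bump + len thompson_A"
    using len_comp[of "?P \<circ> bump" thompson_A] len_comp[of ?P bump] P by (simp del: comp_apply)
  moreover have "len (?P \<circ> thompson_A) \<le> len ?P + len thompson_A"
    using len_comp P by simp
  ultimately have "len (bump_product c (a # w) \<circ> thompson_A [^]\<^bsub>thompson_F\<^esub> length (a # w))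
      \<le> len ?P + len bump + len thompson_A"
    by (auto split: if_splits)
  also have "\<dots> \<le> (len bump + len thompson_A) * length (a # w)"
    using Cons.IH by (simp add: algebra_simps del: comp_apply)
  finally show ?case .
qed

lemma len_bump_product:
  "len (bump_product c w) \<le> (len bump + 2 * len thompson_A) * length w"
proof -
  let ?A = "thompson_A [^]\<^bsub>thompson_F\<^esub> length w"
  have A: "?A \<in> carrier thompson_F" by (rule F.nat_pow_closed) simp
  have "?A \<circ> inv\<^bsub>thompson_F\<^esub> ?A = id"
    using F.r_inv[OF A] by simp
  \<comment> \<open>Removing the appended power costs at most
    \<open>len thompson_A * length w\<close>, the second copy of \<open>len thompson_A\<close> in
    the bound.\<close>
  then have "bump_product c w = (bump_product c w \<circ> ?A) \<circ> inv\<^bsub>thompson_F\<^esub> ?A"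
    by (simp add: comp_assoc)
  then have "len (bump_product c w) \<le> len (bump_product c w \<circ> ?A) + len (inv\<^bsub>thompson_F\<^esub> ?A)"
    using len_comp[of "bump_product c w \<circ> ?A" "inv\<^bsub>thompson_F\<^esub> ?A"] A by simp
  also have "len (inv\<^bsub>thompson_F\<^esub> ?A) \<le> len ?A"
    by (rule F.word_length_inv[OF gen A])
  also have "len ?A \<le> len thompson_A * length w"
    by (rule F.word_length_pow[OF gen]) simp
  finally show ?thesis
    using len_bump_product_pow[of c w] by (simp add: algebra_simps del: comp_apply)
qed

lemma len_witness:
  "len (witness w j) \<le> 2 * (len bump + 2 * len thompson_A) * length w"
proof -
  have "len (witness w j) \<le> len (inv\<^bsub>thompson_F\<^esub> (bump_product (j, False) w)) + len (bump_product (j, True) w)"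
    unfolding witness_def by (rule len_comp) simp_all
  also have "len (inv\<^bsub>thompson_F\<^esub> (bump_product (j, False) w)) \<le> len (bump_product (j, False) w)"
    by (rule F.word_length_inv[OF gen]) simp
  finally show ?thesis
    using len_bump_product[of "(j, False)" w] len_bump_product[of "(j, True)" w]
    by (simp add: algebra_simps)
qed

lemma complexity_thompson_F_le:
  assumes "w \<in> carrier (free_group k)" "w \<noteq> []"
  shows "complexity thompson_F S k w \<le> k * (2 * (len bump + 2 * len thompson_A) * length w)"
proof -
  have "complexity thompson_F S k w \<le> (\<Sum>i = 1..k. len (witness w i))"
    by (rule F.complexity_le) (use assms word_eval_witness_nontrivial in auto)
  also have "\<dots> \<le> (\<Sum>i = 1..k. 2 * (len bump + 2 * len thompson_A) * length w)"
    by (rule sum_mono) (rule len_witness)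
  finally show ?thesis by simp
qed

end

theorem theorem1p5:
  fixes S :: "(real \<Rightarrow> real) set" and k :: nat
  assumes "finite S" and "S \<subseteq> carrier thompson_F"
    and "generate thompson_F S = carrier thompson_F"
    and "k \<ge> 2"
  shows "lawless thompson_F \<and>
    (\<exists>C::real. C > 0 \<and>
      (\<forall>n::nat. n \<ge> 1 \<longrightarrow> real (lawlessness_growth thompson_F S k n) \<le> C * real n))"
proof
  show "lawless thompson_F" by (rule lawless_thompson_F)
  define c where
    "c = k * (2 * (word_length thompson_F S bump + 2 * word_length thompson_F S thompson_A))"
  have growth: "lawlessness_growth thompson_F S k n \<le> c * n" if "n \<ge> 1" for n
  proof -
    let ?W = "{w \<in> carrier (free_group k). w \<noteq> \<one>\<^bsub>free_group k\<^esub> \<and> length w \<le> n}"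
    have "complexity thompson_F S k w \<le> c * n" if "w \<in> ?W" for w
    proof -
      have "complexity thompson_F S k w \<le> c * length w"
        using complexity_thompson_F_le[OF assms(2,3), of w k] that by (simp add: c_def mult.assoc)
      also have "\<dots> \<le> c * n" using that by simp
      finally show ?thesis .
    qed
    \<comment> \<open>\<open>Max.boundedI\<close> needs a nonempty set.\<close>
    moreover have "?W \<noteq> {}" using words_nonempty[of k n] assms(4) that by simp
    ultimately show ?thesis
      unfolding lawlessness_growth_def using finite_words[of k n]
      by (intro Max.boundedI) blast+
  qed
  \<comment> \<open>The summand 1 makes the constant positive without a proof of
    \<open>c > 0\<close>.\<close>
  have "real (lawlessness_growth thompson_F S k n) \<le> (real c + 1) * real n" if "n \<ge> 1" for n
  proof -
    have "real (lawlessness_growth thompson_F S k n) \<le> real (c * n)"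
      using growth[OF that] by (simp only: of_nat_le_iff)
    then show ?thesis by (simp add: algebra_simps)
  qed
  then show "\<exists>C::real. C > 0 \<and>
      (\<forall>n::nat. n \<ge> 1 \<longrightarrow> real (lawlessness_growth thompson_F S k n) \<le> C * real n)"
    by (intro exI[of _ "real c + 1"]) auto
qed

end
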